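(* Let $L$ be a countable classical signature and $F$ a fragment of $L_{\omega_1\omega}(L)$. Suppose that $M\in\mathrm{Mod}(L)$ and $1\le\alpha<\omega_1$ satisfy $[M]\in\boldsymbol{\Pi}^0_{1+\alpha}(t_F)$. Then $[M]=\{N\in\mathrm{Mod}(L):\mathrm{Th}^\alpha_F(N)=\mathrm{Th}^\alpha_F(M)\}$.
   Context: Classical countable structures. $\mathrm{Mod}(L)$ is the Polish space of $L$-structures with universe $\mathbb N$; $[M]$ is the isomorphism class of $M$. A fragment $F$ is a countable set of $L_{\omega_1\omega}(L)$-formulas containing the atomic formulas and closed under subformulas, finitary connectives, quantifiers and substitution of terms for variables. $t_F$ is the topology on $\mathrm{Mod}(L)$ generated by the sets $\{M: M\models\phi(\bar a)\}$, $\phi\in F$, $\bar a\in\mathbb N^{<\mathbb N}$. For $\bar a\in\mathbb N^{<\mathbb N}$ in $M$: $\mathrm{tp}^0(\bar a)=\mathrm{tp}_F(\bar a)$ (the set of $F$-formulas satisfied by $\bar a$ in $M$), and for $\alpha>0$, $\mathrm{tp}^\alpha(\bar a)=\{\mathrm{tp}^\beta(\bar b):\beta<\alpha,\ \bar b\in\mathbb N^{<\mathbb N},\ \bar a\subseteq\bar b\}$, where $\bar a\subseteq\bar b$ means $\bar b$ extends $\bar a$; $\mathrm{Th}^\alpha_F(M)=\mathrm{tp}^\alpha(\emptyset)$ computed in $M$. *)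

theory Defs
  imports
    "HOL-Analysis.Analysis"
    "HOL-Library.Countable_Set_Type"
    "HOL-Library.Sublist"
begin

section \<open>Countable ordinals\<close>

text \<open>A countable ordinal is an isomorphism type of well-orders of subsets of the naturals, so that
  the type below is the set of all ordinals below \<open>\<omega>\<^sub>1\<close>. The condition \<open>(r, s) \<in> ordIso\<close> entails that both
  \<open>r\<close> and \<open>s\<close> are well-orders on their fields.\<close>

quotient_type cord = "nat rel" / partial: "\<lambda>r s. (r, s) \<in> ordIso"
proof (rule part_equivpI)
  have "({} :: nat rel, {} :: nat rel) \<in> ordIso"
    by (rule ordIso_reflexive) simp
  then show "\<exists>r :: nat rel. (r, r) \<in> ordIso" by blast
  show "symp (\<lambda>r s :: nat rel. (r, s) \<in> ordIso)"
    by (auto intro: sympI ordIso_symmetric)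
  show "transp (\<lambda>r s :: nat rel. (r, s) \<in> ordIso)"
    by (auto intro: transpI ordIso_transitive)
qed

lemma ordIso_Well_order: "(r, s) \<in> ordIso \<Longrightarrow> Well_order r \<and> Well_order s"
  by (simp add: ordIso_def)

instantiation cord :: linorder
begin

lift_definition less_eq_cord :: "cord \<Rightarrow> cord \<Rightarrow> bool" is "\<lambda>r s. (r, s) \<in> ordLeq"
  by (metis ordIso_ordLeq_trans ordIso_symmetric ordLeq_ordIso_trans)

lift_definition less_cord :: "cord \<Rightarrow> cord \<Rightarrow> bool" is "\<lambda>r s. (r, s) \<in> ordLess"
  by (metis ordIso_ordLess_trans ordIso_symmetric ordLess_ordIso_trans)

instance
proof
  fix x y z :: cord
  show "(x < y) = (x \<le> y \<and> \<not> y \<le> x)"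
    by transfer (metis not_ordLess_ordLeq ordIso_Well_order ordLess_imp_ordLeq ordLess_or_ordLeq)
  show "x \<le> x"
    by transfer (metis ordIso_iff_ordLeq)
  show "x \<le> y \<Longrightarrow> y \<le> z \<Longrightarrow> x \<le> z"
    by transfer (metis ordLeq_transitive)
  show "x \<le> y \<Longrightarrow> y \<le> x \<Longrightarrow> x = y"
    by transfer (metis ordIso_iff_ordLeq)
  show "x \<le> y \<or> y \<le> x"
    by transfer (metis ordIso_Well_order ordLeq_total)
qed

end

instance cord :: wellorder
proof
  fix P :: "cord \<Rightarrow> bool" and a
  assume step: "\<And>x. (\<And>y. y < x \<Longrightarrow> P y) \<Longrightarrow> P x"
  have "wf {(x, y :: cord). x < y}"
  proof (rule wf_subset)
    show "wf (inv_image (ordLess :: (nat rel \<times> nat rel) set) rep_cord)"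
      by (simp add: wf_ordLess)
    show "{(x, y). x < y} \<subseteq> inv_image (ordLess :: (nat rel \<times> nat rel) set) rep_cord"
      by (auto simp: less_cord_def map_fun_def)
  qed
  then show "P a"
  proof (induction a rule: wf_induct_rule)
    case (less x)
    then show ?case using step[of x] by simp
  qed
qed

lemma abs_cord_less: "Well_order r \<Longrightarrow> Well_order s \<Longrightarrow> abs_cord r < abs_cord s \<longleftrightarrow> (r, s) \<in> ordLess"
  by (simp add: less_cord.abs_eq ordIso_reflexive)

lemma cord_cases: obtains r where "Well_order r" "a = abs_cord r"
proof
  show "Well_order (rep_cord a)"
    using Quotient3_rep_reflp[OF Quotient3_cord, of a] ordIso_Well_order by blast
  show "a = abs_cord (rep_cord a)"
    by (simp add: Quotient3_abs_rep[OF Quotient3_cord])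
qed

lemma countable_lessThan_cord: "countable {..<a :: cord}"
proof -
  obtain r where r: "Well_order r" "a = abs_cord r" by (rule cord_cases)
  have "{..<a} \<subseteq> (\<lambda>x. abs_cord (Restr r (underS r x))) ` Field r"
  proof
    fix b assume "b \<in> {..<a}"
    moreover obtain s where s: "Well_order s" "b = abs_cord s" by (rule cord_cases)
    ultimately have "(s, r) \<in> ordLess" using r by (simp add: abs_cord_less)
    then obtain x where "x \<in> Field r" "(s, Restr r (underS r x)) \<in> ordIso"
      using ordLess_iff_ordIso_Restr r(1) s(1) by blast
    then show "b \<in> (\<lambda>x. abs_cord (Restr r (underS r x))) ` Field r"
      using s(2) Quotient3_rel[OF Quotient3_cord] by blast
  qed
  then show ?thesis by (rule countable_subset) simp
qed

lemma countable_bounded_cord: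
  assumes "countable A"
  shows "\<exists>b :: cord. \<forall>a\<in>A. a < b"
proof (rule ccontr)
  assume "\<not> ?thesis"
  then have "UNIV = (\<Union>a\<in>A. insert a {..<a})"
    by (fastforce simp: not_less order_le_less)
  then have cnt: "countable (UNIV :: cord set)"
    by (metis (no_types, lifting) assms countable_UN countable_insert countable_lessThan_cord)
  define f where "f = to_nat_on (UNIV :: cord set)"
  have f: "f a = f b \<longleftrightarrow> a = b" for a b
    by (simp add: f_def cnt)
  define r where "r = {(f a, f b) | a b. a \<le> b}"
  have rf: "(f a, f b) \<in> r \<longleftrightarrow> a \<le> b" for a b
    by (auto simp: r_def f)
  have rD: "\<exists>a b. x = f a \<and> y = f b \<and> a \<le> b" if "(x, y) \<in> r" for x y
    using that by (auto simp: r_def)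
  have Field: "Field r = range f"
    by (fastforce simp: r_def Field_def)
  have "wf (r - Id)"
  proof (rule wf_subset)
    show "wf (inv_image {(x, y :: cord). x < y} (inv f))"
      using wf by (rule wf_inv_image)
    have "inj f" by (simp add: inj_on_def f)
    then show "r - Id \<subseteq> inv_image {(x, y :: cord). x < y} (inv f)"
      by (auto simp: r_def order_le_less)
  qed
  moreover have "refl_on (Field r) r"
    unfolding refl_on_def Field by (auto simp: rf)
  moreover have "trans r"
  proof (rule transI)
    fix x y z assume "(x, y) \<in> r" "(y, z) \<in> r"
    then obtain a b c d where "x = f a" "y = f b" "a \<le> b" "y = f c" "z = f d" "c \<le> d"
      using rD by meson
    then show "(x, z) \<in> r"
      by (metis f order_trans rf)
  qed
  moreover have "antisym r"
  proof (rule antisymI)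
    fix x y assume "(x, y) \<in> r" "(y, x) \<in> r"
    then show "x = y"
      by (metis f order_antisym rD)
  qed
  moreover have "total_on (Field r) r"
    unfolding total_on_def Field by (auto simp: rf)
  moreover have "r \<subseteq> Field r \<times> Field r"
    by (auto simp: Field_def)
  ultimately have wo: "Well_order r"
    by (simp add: well_order_on_def linear_order_on_def partial_order_on_def preorder_on_def)
  have seg: "wo_rel.ofilter r (underS r x)" for x
    using wo by (simp add: wo_rel.underS_ofilter wo_rel_def)
  define g where "g b = abs_cord (Restr r (underS r (f b)))" for b
  have S: "Well_order (Restr r (underS r x))" for x
    using wo by (rule Well_order_Restr)
  have less: "g b < abs_cord r" for b
    unfolding g_def abs_cord_less[OF S wo] using ordLess_iff_ordIso_Restr[OF wo S] Field
    by (auto intro: ordIso_reflexive S)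
  have "g b < g c" if "b < c" for b c
  proof -
    have "underS r (f b) \<subset> underS r (f c)"
      using that by (auto simp: underS_def rf f dest!: rD)
    then show ?thesis
      unfolding g_def abs_cord_less[OF S S]
      using ofilter_subset_ordLess[OF wo seg seg] by blast
  qed
  then have "b \<le> g b" for b
    by (induction b rule: less_induct) (metis less_le_trans not_le order_less_irrefl)
  then show False using less not_le by blast
qed

text \<open>Ordinal addition: \<open>\<alpha> + \<beta>\<close> is the least ordinal that is at least \<open>\<alpha>\<close> and greater than every
  \<open>\<alpha> + \<gamma>\<close> with \<open>\<gamma> < \<beta>\<close>; it exists by \<open>countable_bounded_cord\<close>.\<close>

function cord_add :: "cord \<Rightarrow> cord \<Rightarrow> cord" where
  "cord_add \<alpha> \<beta> = (LEAST \<delta>. \<alpha> \<le> \<delta> \<and> (\<forall>\<gamma>\<in>{..<\<beta>}. cord_add \<alpha> \<gamma> < \<delta>))"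
  by auto
termination by (relation "inv_image {(x, y). x < y} snd") (auto intro: wf)

declare cord_add.simps [simp del]

instantiation cord :: "{zero, one, plus}"
begin
definition zero_cord :: cord where "(0 :: cord) = (LEAST \<alpha>. True)"
definition one_cord :: cord where "(1 :: cord) = (LEAST \<alpha>. 0 < \<alpha>)"
definition plus_cord :: "cord \<Rightarrow> cord \<Rightarrow> cord" where "\<alpha> + \<beta> = cord_add \<alpha> \<beta>"
instance ..
end


section \<open>The Borel hierarchy of a topological space\<close>

inductive Sigma0 :: "'a topology \<Rightarrow> cord \<Rightarrow> 'a set \<Rightarrow> bool"
  and Pi0 :: "'a topology \<Rightarrow> cord \<Rightarrow> 'a set \<Rightarrow> bool"
  for X :: "'a topology"
where
  Sigma0_open: "openin X U \<Longrightarrow> Sigma0 X 1 U"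
| Sigma0_Union: "1 < \<xi> \<Longrightarrow> (\<And>n :: nat. 1 \<le> \<eta> n \<and> \<eta> n < \<xi> \<and> Pi0 X (\<eta> n) (A n))
    \<Longrightarrow> Sigma0 X \<xi> (\<Union>n. A n)"
| Pi0_compl: "Sigma0 X \<xi> U \<Longrightarrow> Pi0 X \<xi> (topspace X - U)"


section \<open>Signatures and formulas\<close>

record ('f, 'r) signature =
  funs :: "'f set"
  rels :: "'r set"
  farity :: "'f \<Rightarrow> nat"
  rarity :: "'r \<Rightarrow> nat"

definition countable_signature :: "('f, 'r) signature \<Rightarrow> bool" where
  "countable_signature L \<longleftrightarrow> countable (funs L) \<and> countable (rels L)"

datatype 'f trm = Var nat | App 'f "'f trm list"

text \<open>Formulas are taken up to renaming of bound variables, by means of de Bruijn indices: \<open>Exists\<close> and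
  \<open>Forall\<close> bind variable \<open>0\<close> of their body, whose variable \<open>Suc i\<close> is variable \<open>i\<close> outside.\<close>

datatype ('f, 'r) fm =
    Eq "'f trm" "'f trm"
  | Rel 'r "'f trm list"
  | Neg "('f, 'r) fm"
  | And "('f, 'r) fm" "('f, 'r) fm"
  | Or "('f, 'r) fm" "('f, 'r) fm"
  | Conj "nat \<Rightarrow> ('f, 'r) fm"
  | Disj "nat \<Rightarrow> ('f, 'r) fm"
  | Exists "('f, 'r) fm"
  | Forall "('f, 'r) fm"

primrec tvars :: "'f trm \<Rightarrow> nat set" where
  "tvars (Var i) = {i}"
| "tvars (App f ts) = \<Union> (set (map tvars ts))"

primrec fv :: "('f, 'r) fm \<Rightarrow> nat set" where
  "fv (Eq s t) = tvars s \<union> tvars t"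
| "fv (Rel R ts) = \<Union> (set (map tvars ts))"
| "fv (Neg \<phi>) = fv \<phi>"
| "fv (And \<phi> \<psi>) = fv \<phi> \<union> fv \<psi>"
| "fv (Or \<phi> \<psi>) = fv \<phi> \<union> fv \<psi>"
| "fv (Conj \<Phi>) = (\<Union>n. fv (\<Phi> n))"
| "fv (Disj \<Phi>) = (\<Union>n. fv (\<Phi> n))"
| "fv (Exists \<phi>) = {i. Suc i \<in> fv \<phi>}"
| "fv (Forall \<phi>) = {i. Suc i \<in> fv \<phi>}"

primrec is_term :: "('f, 'r) signature \<Rightarrow> 'f trm \<Rightarrow> bool" where
  "is_term L (Var i) \<longleftrightarrow> True"
| "is_term L (App f ts) \<longleftrightarrow>
    f \<in> funs L \<and> length ts = farity L f \<and> list_all (\<lambda>b. b) (map (is_term L) ts)"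

text \<open>As usual for \<open>L\<^bsub>\<omega>\<^sub>1\<omega>\<^esub>\<close>, a formula has only finitely many free variables.\<close>

primrec is_formula :: "('f, 'r) signature \<Rightarrow> ('f, 'r) fm \<Rightarrow> bool" where
  "is_formula L (Eq s t) \<longleftrightarrow> is_term L s \<and> is_term L t"
| "is_formula L (Rel R ts) \<longleftrightarrow> R \<in> rels L \<and> length ts = rarity L R \<and> list_all (is_term L) ts"
| "is_formula L (Neg \<phi>) \<longleftrightarrow> is_formula L \<phi>"
| "is_formula L (And \<phi> \<psi>) \<longleftrightarrow> is_formula L \<phi> \<and> is_formula L \<psi>"
| "is_formula L (Or \<phi> \<psi>) \<longleftrightarrow> is_formula L \<phi> \<and> is_formula L \<psi>"
| "is_formula L (Conj \<Phi>) \<longleftrightarrow> (\<forall>n. is_formula L (\<Phi> n)) \<and> finite (fv (Conj \<Phi>))"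
| "is_formula L (Disj \<Phi>) \<longleftrightarrow> (\<forall>n. is_formula L (\<Phi> n)) \<and> finite (fv (Disj \<Phi>))"
| "is_formula L (Exists \<phi>) \<longleftrightarrow> is_formula L \<phi>"
| "is_formula L (Forall \<phi>) \<longleftrightarrow> is_formula L \<phi>"

primrec tsubst :: "(nat \<Rightarrow> 'f trm) \<Rightarrow> 'f trm \<Rightarrow> 'f trm" where
  "tsubst \<sigma> (Var i) = \<sigma> i"
| "tsubst \<sigma> (App f ts) = App f (map (tsubst \<sigma>) ts)"

definition lift_subst :: "(nat \<Rightarrow> 'f trm) \<Rightarrow> nat \<Rightarrow> 'f trm" where
  "lift_subst \<sigma> = case_nat (Var 0) (\<lambda>i. tsubst (\<lambda>j. Var (Suc j)) (\<sigma> i))"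

primrec subst :: "(nat \<Rightarrow> 'f trm) \<Rightarrow> ('f, 'r) fm \<Rightarrow> ('f, 'r) fm" where
  "subst \<sigma> (Eq s t) = Eq (tsubst \<sigma> s) (tsubst \<sigma> t)"
| "subst \<sigma> (Rel R ts) = Rel R (map (tsubst \<sigma>) ts)"
| "subst \<sigma> (Neg \<phi>) = Neg (subst \<sigma> \<phi>)"
| "subst \<sigma> (And \<phi> \<psi>) = And (subst \<sigma> \<phi>) (subst \<sigma> \<psi>)"
| "subst \<sigma> (Or \<phi> \<psi>) = Or (subst \<sigma> \<phi>) (subst \<sigma> \<psi>)"
| "subst \<sigma> (Conj \<Phi>) = Conj (\<lambda>n. subst \<sigma> (\<Phi> n))"
| "subst \<sigma> (Disj \<Phi>) = Disj (\<lambda>n. subst \<sigma> (\<Phi> n))"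
| "subst \<sigma> (Exists \<phi>) = Exists (subst (lift_subst \<sigma>) \<phi>)"
| "subst \<sigma> (Forall \<phi>) = Forall (subst (lift_subst \<sigma>) \<phi>)"

fun immediate_subformulas :: "('f, 'r) fm \<Rightarrow> ('f, 'r) fm set" where
  "immediate_subformulas (Eq s t) = {}"
| "immediate_subformulas (Rel R ts) = {}"
| "immediate_subformulas (Neg \<phi>) = {\<phi>}"
| "immediate_subformulas (And \<phi> \<psi>) = {\<phi>, \<psi>}"
| "immediate_subformulas (Or \<phi> \<psi>) = {\<phi>, \<psi>}"
| "immediate_subformulas (Conj \<Phi>) = range \<Phi>"
| "immediate_subformulas (Disj \<Phi>) = range \<Phi>"
| "immediate_subformulas (Exists \<phi>) = {\<phi>}"
| "immediate_subformulas (Forall \<phi>) = {\<phi>}"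

text \<open>Closure under quantification over an arbitrary variable follows from closure under
  quantification over variable \<open>0\<close> and under substitution.\<close>

definition fragment :: "('f, 'r) signature \<Rightarrow> ('f, 'r) fm set \<Rightarrow> bool" where
  "fragment L F \<longleftrightarrow>
     countable F \<and> (\<forall>\<phi>\<in>F. is_formula L \<phi>) \<and>
     (\<forall>s t. is_formula L (Eq s t) \<longrightarrow> Eq s t \<in> F) \<and>
     (\<forall>R ts. is_formula L (Rel R ts) \<longrightarrow> Rel R ts \<in> F) \<and>
     (\<forall>\<phi>\<in>F. immediate_subformulas \<phi> \<subseteq> F) \<and>
     (\<forall>\<phi>\<in>F. Neg \<phi> \<in> F) \<and>
     (\<forall>\<phi>\<in>F. \<forall>\<psi>\<in>F. And \<phi> \<psi> \<in> F \<and> Or \<phi> \<psi> \<in> F) \<and>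
     (\<forall>\<phi>\<in>F. Exists \<phi> \<in> F \<and> Forall \<phi> \<in> F) \<and>
     (\<forall>\<phi>\<in>F. \<forall>\<sigma>. (\<forall>i. is_term L (\<sigma> i)) \<longrightarrow> subst \<sigma> \<phi> \<in> F)"


section \<open>Structures with universe the natural numbers\<close>

record ('f, 'r) lstruct =
  fint :: "'f \<Rightarrow> nat list \<Rightarrow> nat"
  rint :: "'r \<Rightarrow> nat list \<Rightarrow> bool"

text \<open>Interpretations are fixed outside the symbols of \<open>L\<close> and argument lists of the right length,
  so that elements of \<open>Mod L\<close> correspond bijectively to \<open>L\<close>-structures on the naturals.\<close>

definition Mod :: "('f, 'r) signature \<Rightarrow> ('f, 'r) lstruct set" where
  "Mod L = {M.
     (\<forall>f xs. \<not> (f \<in> funs L \<and> length xs = farity L f) \<longrightarrow> fint M f xs = undefined) \<and>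
     (\<forall>R xs. \<not> (R \<in> rels L \<and> length xs = rarity L R) \<longrightarrow> \<not> rint M R xs)}"

definition isomorphic ::
    "('f, 'r) signature \<Rightarrow> ('f, 'r) lstruct \<Rightarrow> ('f, 'r) lstruct \<Rightarrow> bool" where
  "isomorphic L M N \<longleftrightarrow> (\<exists>h :: nat \<Rightarrow> nat. bij h \<and>
     (\<forall>f\<in>funs L. \<forall>xs. length xs = farity L f \<longrightarrow> h (fint M f xs) = fint N f (map h xs)) \<and>
     (\<forall>R\<in>rels L. \<forall>xs. length xs = rarity L R \<longrightarrow> rint M R xs = rint N R (map h xs)))"

definition iso_class :: "('f, 'r) signature \<Rightarrow> ('f, 'r) lstruct \<Rightarrow> ('f, 'r) lstruct set" where
  "iso_class L M = {N \<in> Mod L. isomorphic L M N}"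

primrec tval :: "('f, 'r) lstruct \<Rightarrow> (nat \<Rightarrow> nat) \<Rightarrow> 'f trm \<Rightarrow> nat" where
  "tval M e (Var i) = e i"
| "tval M e (App f ts) = fint M f (map (tval M e) ts)"

primrec sat :: "('f, 'r) lstruct \<Rightarrow> (nat \<Rightarrow> nat) \<Rightarrow> ('f, 'r) fm \<Rightarrow> bool" where
  "sat M e (Eq s t) \<longleftrightarrow> tval M e s = tval M e t"
| "sat M e (Rel R ts) \<longleftrightarrow> rint M R (map (tval M e) ts)"
| "sat M e (Neg \<phi>) \<longleftrightarrow> \<not> sat M e \<phi>"
| "sat M e (And \<phi> \<psi>) \<longleftrightarrow> sat M e \<phi> \<and> sat M e \<psi>"
| "sat M e (Or \<phi> \<psi>) \<longleftrightarrow> sat M e \<phi> \<or> sat M e \<psi>"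
| "sat M e (Conj \<Phi>) \<longleftrightarrow> (\<forall>n. sat M e (\<Phi> n))"
| "sat M e (Disj \<Phi>) \<longleftrightarrow> (\<exists>n. sat M e (\<Phi> n))"
| "sat M e (Exists \<phi>) \<longleftrightarrow> (\<exists>x. sat M (case_nat x e) \<phi>)"
| "sat M e (Forall \<phi>) \<longleftrightarrow> (\<forall>x. sat M (case_nat x e) \<phi>)"

text \<open>\<open>M \<Turnstile> \<phi>(a\<^sub>0, \<dots>, a\<^sub>n\<^sub>-\<^sub>1)\<close>, which presupposes that the free variables of \<open>\<phi>\<close> are among the
  first \<open>n\<close>; the \<open>i\<close>-th entry of the tuple is the value of variable \<open>i\<close>.\<close>

definition models :: "('f, 'r) lstruct \<Rightarrow> ('f, 'r) fm \<Rightarrow> nat list \<Rightarrow> bool" where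
  "models M \<phi> a \<longleftrightarrow> fv \<phi> \<subseteq> {..<length a} \<and> sat M ((!) a) \<phi>"

definition t_top ::
    "('f, 'r) signature \<Rightarrow> ('f, 'r) fm set \<Rightarrow> ('f, 'r) lstruct topology" where
  "t_top L F = topology_generated_by {{M \<in> Mod L. models M \<phi> a} | \<phi> a. \<phi> \<in> F}"


section \<open>Iterated types\<close>

text \<open>Values of \<open>tp\<^sup>\<alpha>\<close>: sets of formulas for \<open>\<alpha> = 0\<close>, and countable sets of such values otherwise.\<close>

datatype ('f, 'r) htype = Base "('f, 'r) fm set" | Node "('f, 'r) htype cset"

function tp ::
    "('f, 'r) fm set \<Rightarrow> ('f, 'r) lstruct \<Rightarrow> cord \<Rightarrow> nat list \<Rightarrow> ('f, 'r) htype" where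
  "tp F M \<alpha> a =
     (if \<alpha> = 0 then Base {\<phi> \<in> F. models M \<phi> a}
      else Node (acset (\<Union>\<beta>\<in>{..<\<alpha>}. {tp F M \<beta> b | b. prefix a b})))"
  by auto
termination by (relation "inv_image {(x, y). x < y} (\<lambda>(F, M, \<alpha>, a). \<alpha>)") (auto intro: wf)

declare tp.simps [simp del]

lemma tp_Node:
  assumes "\<alpha> \<noteq> 0"
  shows "\<exists>A. tp F M \<alpha> a = Node A \<and> rcset A = {tp F M \<beta> b | \<beta> b. \<beta> < \<alpha> \<and> prefix a b}"
proof -
  have "countable {tp F M \<beta> b | b. prefix a b}" for \<beta>
    by (rule countable_subset[of _ "range (tp F M \<beta>)"]) auto
  then have "countable (\<Union>\<beta>\<in>{..<\<alpha>}. {tp F M \<beta> b | b. prefix a b})"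
    by (intro countable_UN countable_lessThan_cord)
  then have "rcset (acset (\<Union>\<beta>\<in>{..<\<alpha>}. {tp F M \<beta> b | b. prefix a b}))
      = {tp F M \<beta> b | \<beta> b. \<beta> < \<alpha> \<and> prefix a b}"
    by (subst acset_inverse) auto
  with assms show ?thesis by (subst tp.simps) auto
qed

definition Th :: "('f, 'r) fm set \<Rightarrow> cord \<Rightarrow> ('f, 'r) lstruct \<Rightarrow> ('f, 'r) htype" where
  "Th F \<alpha> M = tp F M \<alpha> []"

end

theory Submission
  imports Defs
begin

text \<open>Use category forcing with permutations \<open>g\<close> of \<open>\<nat>\<close>, the conditions being injective tuples \<open>p\<close>: say
  that \<open>p\<close> forces \<open>A\<close> over \<open>M\<close> if the isomorphic copy of \<open>M\<close> along \<open>g\<close> lies in \<open>A\<close> for comeagerly many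
  \<open>g\<close> extending \<open>p\<close>. For \<open>A\<close> in \<open>\<Pi>\<^sup>0\<^bsub>1+\<beta>\<^esub>\<close>, whether \<open>p\<close> forces \<open>A\<close> over \<open>M\<close> depends only on \<open>tp\<^sup>\<beta>(p)\<close>: for
  \<open>\<beta> = 0\<close> because the fragment is closed under quantifiers, so that \<open>p\<close> having an extension with a
  given \<open>F\<close>-property is itself an \<open>F\<close>-property of \<open>p\<close>; for \<open>\<beta> > 0\<close> because \<open>p\<close> forces the complement
  of \<open>\<Union>\<^sub>n A\<^sub>n\<close> iff no extension of \<open>p\<close> forces any \<open>A\<^sub>n\<close>. Every copy of \<open>M\<close> lies in \<open>[M]\<close>, so the empty
  tuple forces \<open>[M]\<close> over \<open>M\<close>. If \<open>N\<close> has the same \<open>Th\<^sup>\<alpha>\<close>, the empty tuple forces \<open>[M]\<close> over \<open>N\<close> as well,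
  so some copy of \<open>N\<close> is isomorphic to \<open>M\<close>.\<close>

section \<open>Category forcing with injective finite sequences\<close>

definition initial_segment :: "nat list \<Rightarrow> (nat \<Rightarrow> nat) \<Rightarrow> bool" where
  "initial_segment p g \<longleftrightarrow> map g [0..<length p] = p"

definition dense_tuples :: "nat list set \<Rightarrow> bool" where
  "dense_tuples D \<longleftrightarrow> (\<forall>p. distinct p \<longrightarrow> (\<exists>q\<in>D. distinct q \<and> prefix p q))"

text \<open>The second clause puts \<open>g\<close> into the open dense sets of permutations coded
  by \<open>\<D>\<close>.\<close>

definition generic :: "nat list set set \<Rightarrow> (nat \<Rightarrow> nat) \<Rightarrow> bool" where
  "generic \<D> g \<longleftrightarrow> bij g \<and> (\<forall>D\<in>\<D>. \<exists>q\<in>D. initial_segment q g)"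

text \<open>That is, \<open>S\<close> is comeager in the space of permutations of \<open>\<nat>\<close> extending \<open>p\<close>.\<close>

definition forces :: "nat list \<Rightarrow> (nat \<Rightarrow> nat) set \<Rightarrow> bool" where
  "forces p S \<longleftrightarrow> (\<exists>\<D>. countable \<D> \<and> (\<forall>D\<in>\<D>. dense_tuples D) \<and>
     (\<forall>g. generic \<D> g \<and> initial_segment p g \<longrightarrow> g \<in> S))"

text \<open>Comeager or meager locally at densely many conditions: this is the Baire property of
  \<open>S\<close>.\<close>

definition decided :: "(nat \<Rightarrow> nat) set \<Rightarrow> bool" where
  "decided S \<longleftrightarrow> dense_tuples {q. forces q S \<or> forces q (- S)}"

lemma initial_segment_prefix:
  assumes "prefix p q" "initial_segment q g"
  shows "initial_segment p g"
proof -
  obtain r where q: "q = p @ r" using assms(1) by (auto simp: prefix_def)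
  have "take (length p) (map g [0..<length q]) = p"
    using assms(2) q by (simp add: initial_segment_def)
  then show ?thesis
    by (simp add: initial_segment_def take_map q)
qed

lemma initial_segment_upt: "initial_segment (map g [0..<k]) g"
  by (simp add: initial_segment_def)

lemma initial_segment_nth: "initial_segment p g \<Longrightarrow> i < length p \<Longrightarrow> p ! i = g i"
  unfolding initial_segment_def by (metis add_0 diff_zero length_upt nth_map nth_upt)

lemma initial_segments_comparable:
  assumes "initial_segment p g" "initial_segment q g" "length p \<le> length q"
  shows "prefix p q"
proof -
  have "take (length p) q = p"
    using assms by (intro nth_equalityI) (auto simp: initial_segment_nth)
  then show ?thesis by (metis take_is_prefix)
qed

lemma initial_segment_prefix_upt:
  "initial_segment p g \<Longrightarrow> length p \<le> k \<Longrightarrow> prefix p (map g [0..<k])"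
  by (rule initial_segments_comparable[OF _ initial_segment_upt]) auto

lemma forces_mono: "forces p S \<Longrightarrow> S \<subseteq> T \<Longrightarrow> forces p T"
  unfolding forces_def by (meson subsetD)

lemma forces_prefix: "forces p S \<Longrightarrow> prefix p q \<Longrightarrow> forces q S"
  unfolding forces_def by (meson initial_segment_prefix)

lemma forces_all: "(\<And>g. bij g \<Longrightarrow> initial_segment p g \<Longrightarrow> g \<in> S) \<Longrightarrow> forces p S"
  unfolding forces_def by (intro exI[of _ "{}"]) (auto simp: generic_def)

text \<open>Pool the countably many families of dense sets: a permutation generic for the union is
  generic for each of them.\<close>

lemma forces_INT:
  assumes "\<And>n :: nat. forces p (S n)"
  shows "forces p (\<Inter>n. S n)"
proof -
  have "\<forall>n. \<exists>\<D>. countable \<D> \<and> (\<forall>D\<in>\<D>. dense_tuples D) \<and>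
     (\<forall>g. generic \<D> g \<and> initial_segment p g \<longrightarrow> g \<in> S n)"
    using assms by (simp add: forces_def)
  then obtain \<D> where \<D>: "\<And>n. countable (\<D> n)" "\<And>n. \<forall>D\<in>\<D> n. dense_tuples D"
    "\<And>n g. generic (\<D> n) g \<Longrightarrow> initial_segment p g \<Longrightarrow> g \<in> S n"
    by metis
  have "generic (\<D> n) g" if "generic (\<Union>n. \<D> n) g" for g n
    using that by (auto simp: generic_def)
  with \<D> show ?thesis
    unfolding forces_def by (intro exI[of _ "\<Union>n. \<D> n"]) auto
qed

section \<open>Existence of generic permutations\<close>

lemma dense_tuples_contains: "dense_tuples {q. {..n} \<subseteq> set q}"
  unfolding dense_tuples_def
proof (intro allI impI)
  fix p :: "nat list" assume "distinct p"
  then show "\<exists>q\<in>{q. {..n} \<subseteq> set q}. distinct q \<and> prefix p q"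
    by (intro bexI[of _ "p @ filter (\<lambda>x. x \<notin> set p) [0..<Suc n]"])
      (auto simp del: upt_Suc)
qed

text \<open>Rasiowa-Sikorski: extend \<open>p\<close> step by step into each dense set; the union of
  the chain is \<open>g\<close>.\<close>

lemma generic_exists:
  assumes "countable \<D>" "\<And>D. D \<in> \<D> \<Longrightarrow> dense_tuples D" "distinct p"
  obtains g where "generic \<D> g" "initial_segment p g"
proof -
  \<comment> \<open>The added sets put every number into the range of some stage, which makes the
    limit total and surjective.\<close>
  define \<E> where "\<E> = \<D> \<union> range (\<lambda>n. {q. {..n} \<subseteq> set q})"
  define E where "E = from_nat_into \<E>"
  have "\<E> \<noteq> {}" "countable \<E>" using assms(1) by (auto simp: \<E>_def)
  then have E: "range E = \<E>" unfolding E_def by (rule range_from_nat_into)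
  have "dense_tuples D" if "D \<in> \<E>" for D
    using that assms(2) dense_tuples_contains by (auto simp: \<E>_def)
  then have "dense_tuples (E n)" for n
    using E by blast
  then have "\<forall>n q. \<exists>r. distinct q \<longrightarrow> r \<in> E n \<and> distinct r \<and> prefix q r"
    unfolding dense_tuples_def by blast
  then obtain ext where ext: "\<And>n q. distinct q \<Longrightarrow>
      ext n q \<in> E n \<and> distinct (ext n q) \<and> prefix q (ext n q)"
    by metis
  define s where "s = rec_nat p ext"
  have s0: "s 0 = p" and sS: "s (Suc n) = ext n (s n)" for n
    by (simp_all add: s_def)
  have dist: "distinct (s n)" for n
    by (induction n) (auto simp: s0 sS assms(3) ext)
  have step: "prefix (s n) (s (Suc n))" and inE: "s (Suc n) \<in> E n" for n
    using ext[OF dist] by (auto simp: sS)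
  have chain: "prefix (s m) (s n)" if "m \<le> n" for m n
    using that by (induction n rule: dec_induct) (auto intro: step prefix_order.order_trans)
  have covers: "\<exists>m. {..n} \<subseteq> set (s m)" for n
  proof -
    have "{q. {..n} \<subseteq> set q} \<in> range E" unfolding E by (auto simp: \<E>_def)
    then show ?thesis using inE by (metis (mono_tags, lifting) imageE mem_Collect_eq)
  qed
  have long: "\<exists>m. n < length (s m)" for n
  proof -
    obtain m where "{..n} \<subseteq> set (s m)" using covers by blast
    then have "card {..n} \<le> card (set (s m))" by (intro card_mono) auto
    then show ?thesis using card_length[of "s m"] by (intro exI[of _ m]) simp
  qed
  have agree: "s m ! i = s n ! i" if "i < length (s m)" "i < length (s n)" for m n i
    using chain[of m n] chain[of n m] that
    by (metis nle_le nth_append prefix_def)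
  \<comment> \<open>\<open>long\<close> provides a stage that reaches position \<open>i\<close>, and
    by \<open>agree\<close> any such stage gives the same value.\<close>
  define g where "g i = s (SOME m. i < length (s m)) ! i" for i
  have g: "g i = s n ! i" if "i < length (s n)" for i n
    unfolding g_def using someI_ex[OF long[of i]] that by (rule agree)
  have seg: "initial_segment (s n) g" for n
    unfolding initial_segment_def by (rule nth_equalityI) (auto simp: g)
  have "inj g"
  proof (rule injI)
    fix i j assume ij: "g i = g j"
    obtain m where "max i j < length (s m)" using long by blast
    then show "i = j" using ij g[of i m] g[of j m] dist[of m] by (simp add: nth_eq_iff_index_eq)
  qed
  moreover have "surj g"
    unfolding surj_def
  proof
    fix y
    obtain m where "{..y} \<subseteq> set (s m)" using covers by blast
    then obtain i where "i < length (s m)" "s m ! i = y" by (auto simp: in_set_conv_nth subset_iff)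
    then show "\<exists>x. y = g x" using g by metis
  qed
  moreover have "\<exists>q\<in>D. initial_segment q g" if "D \<in> \<D>" for D
  proof -
    have "D \<in> range E" using that by (auto simp: E \<E>_def)
    then show ?thesis using inE seg by blast
  qed
  ultimately have "generic \<D> g" by (simp add: generic_def bij_def)
  then show thesis using that seg[of 0] s0 by simp
qed

text \<open>Baire category for the permutation group; \<open>distinct p\<close> makes the basic open
  set of \<open>p\<close> nonempty.\<close>

lemma forces_generic:
  assumes "forces p S" "distinct p"
  obtains g where "bij g" "initial_segment p g" "g \<in> S"
proof -
  obtain \<D> where \<D>: "countable \<D>" "\<And>D. D \<in> \<D> \<Longrightarrow> dense_tuples D"
    "\<And>g. generic \<D> g \<Longrightarrow> initial_segment p g \<Longrightarrow> g \<in> S"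
    using assms(1) by (auto simp: forces_def)
  obtain g where "generic \<D> g" "initial_segment p g"
    using generic_exists[OF \<D>(1,2) assms(2)] by blast
  with \<D>(3) show thesis using that unfolding generic_def by blast
qed

lemma forces_Int:
  assumes "forces p S" "forces p T"
  shows "forces p (S \<inter> T)"
proof -
  have "forces p (\<Inter>n :: nat. if n = 0 then S else T)"
    by (rule forces_INT) (simp add: assms)
  then show ?thesis by (rule forces_mono) (use zero_neq_one in \<open>force split: if_splits\<close>)
qed

section \<open>Forcing complements and countable unions\<close>

lemma not_forces_Compl:
  assumes "forces p S" "distinct p"
  shows "\<not> forces p (- S)"
  using forces_generic[OF forces_Int[OF assms(1)] assms(2)] by blast

text \<open>The forcing clause for negation. From right to left, a sufficiently generic
  \<open>g\<close> through \<open>p\<close> passes through a deciding condition \<open>q\<close>.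
  Both lie on \<open>g\<close>, so one extends the other; hence \<open>q\<close> cannot force
  \<open>S\<close> and forces \<open>- S\<close>.\<close>

lemma forces_Compl_iff:
  assumes "decided S" "distinct p"
  shows "forces p (- S) \<longleftrightarrow> \<not> (\<exists>q. distinct q \<and> prefix p q \<and> forces q S)"
proof
  assume "forces p (- S)"
  then show "\<not> (\<exists>q. distinct q \<and> prefix p q \<and> forces q S)"
    using forces_prefix not_forces_Compl by blast
next
  assume no: "\<not> (\<exists>q. distinct q \<and> prefix p q \<and> forces q S)"
  define D where "D = {q. forces q S \<or> forces q (- S)}"
  \<comment> \<open>One family for each tuple \<open>q\<close>; there are countably many tuples, so
    the union is countable. A \<open>q\<close> that does not force \<open>- S\<close> receives the
    empty family.\<close>
  have "\<forall>q. \<exists>\<D>. countable \<D> \<and> (\<forall>D\<in>\<D>. dense_tuples D) \<and>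
      (forces q (- S) \<longrightarrow> (\<forall>g. generic \<D> g \<and> initial_segment q g \<longrightarrow> g \<in> - S))"
    unfolding forces_def by (metis countable_empty empty_iff)
  then obtain \<D> where \<D>: "\<And>q. countable (\<D> q)" "\<And>q. \<forall>D\<in>\<D> q. dense_tuples D"
    "\<And>q g. forces q (- S) \<Longrightarrow> generic (\<D> q) g \<Longrightarrow> initial_segment q g \<Longrightarrow> g \<in> - S"
    by metis
  define \<E> where "\<E> = insert D (\<Union>q. \<D> q)"
  have "g \<in> - S" if g: "generic \<E> g" "initial_segment p g" for g
  proof -
    obtain q where q: "q \<in> D" "initial_segment q g"
      using g(1) by (auto simp: generic_def \<E>_def)
    have "\<not> forces q S"
    proof
      assume q_forces: "forces q S"
      have "distinct q"
        using g(1) q(2) unfolding generic_def initial_segment_def bij_def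
        by (metis distinct_map distinct_upt inj_on_subset subset_UNIV)
      \<comment> \<open>The longer of \<open>p\<close> and \<open>q\<close> is an injective
        extension of \<open>p\<close> that forces \<open>S\<close>.\<close>
      then show False
        using q_forces initial_segments_comparable[OF q(2) g(2)]
          initial_segments_comparable[OF g(2) q(2)] no assms(2) forces_prefix
        by (meson nle_le prefix_order.order_refl)
    qed
    then have "forces q (- S)" using q(1) by (simp add: D_def)
    moreover have "generic (\<D> q) g" using g(1) by (auto simp: generic_def \<E>_def)
    ultimately show ?thesis using \<D>(3) q(2) by blast
  qed
  moreover have "countable \<E>" using \<D>(1) by (simp add: \<E>_def)
  moreover have "\<forall>D\<in>\<E>. dense_tuples D"
    using \<D>(2) assms(1) by (auto simp: \<E>_def D_def decided_def)
  ultimately show "forces p (- S)" unfolding forces_def by blast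
qed

lemma decided_Compl: "decided (- S) = decided S"
  by (simp add: decided_def disj_commute)

text \<open>Otherwise \<open>p\<close> forces every \<open>- S n\<close>, hence their intersection,
  which is the complement of the union.\<close>

lemma forces_UN:
  assumes "\<And>n :: nat. decided (S n)" "distinct p" "forces p (\<Union>n. S n)"
  obtains n q where "distinct q" "prefix p q" "forces q (S n)"
proof -
  have "\<exists>n q. distinct q \<and> prefix p q \<and> forces q (S n)"
  proof (rule ccontr)
    assume "\<not> ?thesis"
    then have "forces p (- S n)" for n
      using forces_Compl_iff[OF assms(1,2)] by blast
    then have "forces p (\<Inter>n. - S n)" by (rule forces_INT)
    then show False using not_forces_Compl[OF assms(3,2)] by (simp add: Compl_UN)
  qed
  then show thesis using that by blast
qed

text \<open>Either some extension of \<open>p\<close> forces one \<open>S n\<close> and with it the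
  union, or \<open>p\<close> itself forces every \<open>- S n\<close>.\<close>

lemma decided_UN:
  assumes "\<And>n :: nat. decided (S n)"
  shows "decided (\<Union>n. S n)"
  unfolding decided_def dense_tuples_def
proof (intro allI impI)
  fix p :: "nat list" assume p: "distinct p"
  show "\<exists>q\<in>{q. forces q (\<Union>n. S n) \<or> forces q (- (\<Union>n. S n))}. distinct q \<and> prefix p q"
  proof (cases "\<exists>n q. distinct q \<and> prefix p q \<and> forces q (S n)")
    case True
    then show ?thesis using forces_mono by (metis (mono_tags, lifting) UN_upper UNIV_I mem_Collect_eq)
  next
    case False
    then have "forces p (- S n)" for n
      using forces_Compl_iff[OF assms p] by blast
    then have "forces p (\<Inter>n. - S n)" by (rule forces_INT)
    then show ?thesis using p by (intro bexI[of _ p]) (auto simp: Compl_UN)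
  qed
qed


section \<open>Satisfaction\<close>

lemma tval_cong: "(\<And>i. i \<in> tvars t \<Longrightarrow> e i = e' i) \<Longrightarrow> tval M e t = tval M e' t"
proof (induction t)
  case (App f ts)
  have "tval M e t = tval M e' t" if "t \<in> set ts" for t
    by (rule App.IH[OF that]) (use App.prems that in auto)
  then show ?case by (simp cong: map_cong)
qed simp

lemma sat_cong: "(\<And>i. i \<in> fv \<phi> \<Longrightarrow> e i = e' i) \<Longrightarrow> sat M e \<phi> = sat M e' \<phi>"
proof (induction \<phi> arbitrary: e e')
  case (Eq s t)
  then show ?case using tval_cong[of s e e' M] tval_cong[of t e e' M] by auto
next
  case (Rel R ts)
  then have "map (tval M e) ts = map (tval M e') ts"
    by (auto intro: tval_cong)
  then show ?case by (metis sat.simps(2))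
next
  case (Exists \<phi>)
  have "sat M (case_nat x e) \<phi> = sat M (case_nat x e') \<phi>" for x
    by (rule Exists.IH) (use Exists.prems in \<open>auto split: nat.split\<close>)
  then show ?case by simp
next
  case (Forall \<phi>)
  have "sat M (case_nat x e) \<phi> = sat M (case_nat x e') \<phi>" for x
    by (rule Forall.IH) (use Forall.prems in \<open>auto split: nat.split\<close>)
  then show ?case by simp
next
  case (Conj \<Phi>)
  have "sat M e (\<Phi> n) = sat M e' (\<Phi> n)" for n
    by (rule Conj.IH) (use Conj.prems in auto)
  then show ?case by simp
next
  case (Disj \<Phi>)
  have "sat M e (\<Phi> n) = sat M e' (\<Phi> n)" for n
    by (rule Disj.IH) (use Disj.prems in auto)
  then show ?case by simp
next
  case (And \<phi> \<psi>)
  then show ?case by (metis UnCI fv.simps(4) sat.simps(4))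
next
  case (Or \<phi> \<psi>)
  then show ?case by (metis UnCI fv.simps(5) sat.simps(5))
next
  case (Neg \<phi>)
  then show ?case by (metis fv.simps(3) sat.simps(3))
qed

lemma tval_tsubst: "tval M e (tsubst \<sigma> t) = tval M (\<lambda>i. tval M e (\<sigma> i)) t"
  by (induction t) (simp_all add: comp_def cong: map_cong)

lemma tval_lift_subst:
  "(\<lambda>i. tval M (case_nat x e) (lift_subst \<sigma> i)) = case_nat x (\<lambda>i. tval M e (\<sigma> i))"
  by (rule ext) (simp add: lift_subst_def tval_tsubst split: nat.split)

lemma sat_subst: "sat M e (subst \<sigma> \<phi>) = sat M (\<lambda>i. tval M e (\<sigma> i)) \<phi>"
proof (induction \<phi> arbitrary: e \<sigma>)
  case (Rel R ts)
  then show ?case by (simp add: tval_tsubst comp_def)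
qed (simp_all add: tval_tsubst tval_lift_subst)

lemma tvars_tsubst: "tvars (tsubst \<sigma> t) = (\<Union>i\<in>tvars t. tvars (\<sigma> i))"
  by (induction t) auto

text \<open>Accounts for the shift under a binder in \<open>fv_subst\<close>:
  \<open>lift_subst \<sigma>\<close> fixes variable \<open>0\<close> and raises all variables of the
  other terms by one.\<close>

lemma Suc_tvars_lift_subst:
  "{j. \<exists>i\<in>S. Suc j \<in> tvars (lift_subst \<sigma> i)} = (\<Union>i\<in>{i. Suc i \<in> S}. tvars (\<sigma> i))"
proof -
  have "Suc j \<in> tvars (lift_subst \<sigma> i) \<longleftrightarrow> (\<exists>i'. i = Suc i' \<and> j \<in> tvars (\<sigma> i'))" for i j
    by (cases i) (simp_all add: lift_subst_def tvars_tsubst)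
  then show ?thesis by auto
qed

lemma fv_subst: "fv (subst \<sigma> \<phi>) = (\<Union>i\<in>fv \<phi>. tvars (\<sigma> i))"
proof (induction \<phi> arbitrary: \<sigma>)
  case (Exists \<phi>)
  then show ?case using Suc_tvars_lift_subst[of "fv \<phi>" \<sigma>] by simp
next
  case (Forall \<phi>)
  then show ?case using Suc_tvars_lift_subst[of "fv \<phi>" \<sigma>] by simp
qed (auto simp: tvars_tsubst)

section \<open>Invariance under isomorphism\<close>

lemma tval_isomorphism:
  assumes "\<And>f xs. f \<in> funs L \<Longrightarrow> length xs = farity L f \<Longrightarrow> h (fint M f xs) = fint N f (map h xs)"
    and "is_term L t"
  shows "h (tval M e t) = tval N (\<lambda>i. h (e i)) t"
  using assms(2)
proof (induction t)
  case (App f ts)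
  then have "map (\<lambda>t. h (tval M e t)) ts = map (tval N (\<lambda>i. h (e i))) ts"
    by (auto simp: list_all_iff)
  then show ?case using App.prems by (simp add: assms(1) comp_def cong: map_cong)
qed simp

text \<open>Injectivity of \<open>h\<close> serves the equations, surjectivity the
  quantifiers.\<close>

lemma sat_isomorphism:
  assumes "bij h"
    and fint: "\<And>f xs. f \<in> funs L \<Longrightarrow> length xs = farity L f \<Longrightarrow> h (fint M f xs) = fint N f (map h xs)"
    and rint: "\<And>R xs. R \<in> rels L \<Longrightarrow> length xs = rarity L R \<Longrightarrow> rint M R xs = rint N R (map h xs)"
    and "is_formula L \<phi>"
  shows "sat M e \<phi> = sat N (\<lambda>i. h (e i)) \<phi>"
  using assms(4)
proof (induction \<phi> arbitrary: e)
  case (Eq s t)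
  note tv = tval_isomorphism[where L = L and h = h and M = M and N = N, OF fint]
  have "sat M e (Eq s t) \<longleftrightarrow> h (tval M e s) = h (tval M e t)"
    using \<open>bij h\<close> by (simp add: bij_is_inj inj_eq)
  then show ?case using Eq tv[of s e] tv[of t e] by simp
next
  case (Rel R ts)
  note tv = tval_isomorphism[where L = L and h = h and M = M and N = N, OF fint]
  have "map (\<lambda>t. h (tval M e t)) ts = map (tval N (\<lambda>i. h (e i))) ts"
    using Rel tv by (auto simp: list_all_iff)
  then show ?case using Rel.prems by (simp add: rint comp_def cong: map_cong)
next
  case (Exists \<phi>)
  have "(\<lambda>i. h (case_nat x e i)) = case_nat (h x) (\<lambda>i. h (e i))" for x
    by (rule ext) (simp split: nat.split)
  then have "sat M (case_nat x e) \<phi> = sat N (case_nat (h x) (\<lambda>i. h (e i))) \<phi>" for x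
    using Exists by simp
  then show ?case using \<open>bij h\<close> by (metis bij_pointE sat.simps(8))
next
  case (Forall \<phi>)
  have "(\<lambda>i. h (case_nat x e i)) = case_nat (h x) (\<lambda>i. h (e i))" for x
    by (rule ext) (simp split: nat.split)
  then have "sat M (case_nat x e) \<phi> = sat N (case_nat (h x) (\<lambda>i. h (e i))) \<phi>" for x
    using Forall by simp
  then show ?case using \<open>bij h\<close> by (metis bij_pointE sat.simps(9))
qed auto

lemma models_isomorphism:
  assumes "bij h"
    and "\<And>f xs. f \<in> funs L \<Longrightarrow> length xs = farity L f \<Longrightarrow> h (fint M f xs) = fint N f (map h xs)"
    and "\<And>R xs. R \<in> rels L \<Longrightarrow> length xs = rarity L R \<Longrightarrow> rint M R xs = rint N R (map h xs)"
    and "is_formula L \<phi>"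
  shows "models M \<phi> a = models N \<phi> (map h a)"
proof (cases "fv \<phi> \<subseteq> {..<length a}")
  case True
  then have "sat N (\<lambda>i. h (a ! i)) \<phi> = sat N ((!) (map h a)) \<phi>"
    by (intro sat_cong) auto
  moreover have "sat M ((!) a) \<phi> = sat N (\<lambda>i. h (a ! i)) \<phi>"
    by (rule sat_isomorphism[OF assms])
  ultimately show ?thesis by (simp add: models_def)
qed (simp add: models_def)

lemma isomorphic_sym:
  assumes "isomorphic L M N"
  shows "isomorphic L N M"
proof -
  obtain h where h: "bij h"
    "\<And>f xs. f \<in> funs L \<Longrightarrow> length xs = farity L f \<Longrightarrow> h (fint M f xs) = fint N f (map h xs)"
    "\<And>R xs. R \<in> rels L \<Longrightarrow> length xs = rarity L R \<Longrightarrow> rint M R xs = rint N R (map h xs)"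
    using assms unfolding isomorphic_def by blast
  have hi: "h (inv h x) = x" "inv h (h x) = x" for x
    using h(1) by (simp_all add: bij_is_surj surj_f_inv_f bij_is_inj)
  have mh: "map h (map (inv h) xs) = xs" for xs :: "nat list"
    by (simp add: comp_def hi)
  show ?thesis
    unfolding isomorphic_def
  proof (intro exI[of _ "inv h"] conjI ballI allI impI)
    show "bij (inv h)" using h(1) by (rule bij_imp_bij_inv)
  next
    fix f and xs :: "nat list" assume "f \<in> funs L" "length xs = farity L f"
    then show "inv h (fint N f xs) = fint M f (map (inv h) xs)"
      using h(2)[of f "map (inv h) xs"] mh[of xs] hi(2) by (metis length_map)
  next
    fix R and xs :: "nat list" assume "R \<in> rels L" "length xs = rarity L R"
    then show "rint N R xs = rint M R (map (inv h) xs)"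
      using h(3)[of R "map (inv h) xs"] mh[of xs] by simp
  qed
qed

lemma isomorphic_trans:
  assumes "isomorphic L M N" "isomorphic L N K"
  shows "isomorphic L M K"
proof -
  obtain h where h: "bij h"
    "\<And>f xs. f \<in> funs L \<Longrightarrow> length xs = farity L f \<Longrightarrow> h (fint M f xs) = fint N f (map h xs)"
    "\<And>R xs. R \<in> rels L \<Longrightarrow> length xs = rarity L R \<Longrightarrow> rint M R xs = rint N R (map h xs)"
    using assms(1) unfolding isomorphic_def by blast
  obtain k where k: "bij k"
    "\<And>f xs. f \<in> funs L \<Longrightarrow> length xs = farity L f \<Longrightarrow> k (fint N f xs) = fint K f (map k xs)"
    "\<And>R xs. R \<in> rels L \<Longrightarrow> length xs = rarity L R \<Longrightarrow> rint N R xs = rint K R (map k xs)"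
    using assms(2) unfolding isomorphic_def by blast
  show ?thesis
    unfolding isomorphic_def
  proof (intro exI[of _ "k \<circ> h"] conjI ballI allI impI)
    show "bij (k \<circ> h)" using h(1) k(1) by (rule bij_comp)
  next
    fix f and xs :: "nat list" assume "f \<in> funs L" "length xs = farity L f"
    then show "(k \<circ> h) (fint M f xs) = fint K f (map (k \<circ> h) xs)"
      using h(2) k(2)[of f "map h xs"] by simp
  next
    fix R and xs :: "nat list" assume "R \<in> rels L" "length xs = rarity L R"
    then show "rint M R xs = rint K R (map (k \<circ> h) xs)"
      using h(3) k(3)[of R "map h xs"] by simp
  qed
qed

text \<open>The structure for which \<open>g\<close> is an isomorphism onto \<open>M\<close>.
  Functions get a case split because \<open>inv g\<close> may move \<open>undefined\<close>; for
  relations the convention of \<open>Mod L\<close> carries over, as \<open>map g\<close> preserves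
  lengths.\<close>

definition pullback ::
    "('f, 'r) signature \<Rightarrow> (nat \<Rightarrow> nat) \<Rightarrow> ('f, 'r) lstruct \<Rightarrow> ('f, 'r) lstruct" where
  "pullback L g M = \<lparr>
     fint = (\<lambda>f xs. if f \<in> funs L \<and> length xs = farity L f
       then inv g (fint M f (map g xs)) else undefined),
     rint = (\<lambda>R xs. rint M R (map g xs))\<rparr>"

lemma pullback_Mod: "M \<in> Mod L \<Longrightarrow> pullback L g M \<in> Mod L"
  by (auto simp: Mod_def pullback_def)

lemma isomorphic_pullback: "bij g \<Longrightarrow> isomorphic L (pullback L g M) M"
  unfolding isomorphic_def
  by (rule exI[of _ g]) (auto simp: pullback_def bij_is_surj surj_f_inv_f)

lemma models_pullback:
  assumes "bij g" "is_formula L \<phi>"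
  shows "models (pullback L g M) \<phi> a = models M \<phi> (map g a)"
  using assms by (intro models_isomorphism[where L = L])
    (auto simp: pullback_def bij_is_surj surj_f_inv_f)


section \<open>Operations on formulas of a fragment\<close>

context
  fixes L :: "('f, 'r) signature" and F :: "('f, 'r) fm set"
  assumes F: "fragment L F"
begin

lemma F_formula: "\<phi> \<in> F \<Longrightarrow> is_formula L \<phi>"
  and F_Eq: "Eq (Var i) (Var j) \<in> F"
  and F_Neg: "\<phi> \<in> F \<Longrightarrow> Neg \<phi> \<in> F"
  and F_And: "\<phi> \<in> F \<Longrightarrow> \<psi> \<in> F \<Longrightarrow> And \<phi> \<psi> \<in> F"
  and F_Exists: "\<phi> \<in> F \<Longrightarrow> Exists \<phi> \<in> F"
  and F_rename: "\<phi> \<in> F \<Longrightarrow> subst (\<lambda>i. Var (s i)) \<phi> \<in> F"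
  using F unfolding fragment_def by simp_all

lemma models_And: "models M (And \<phi> \<psi>) a \<longleftrightarrow> models M \<phi> a \<and> models M \<psi> a"
  by (auto simp: models_def)

lemma conj_formula:
  assumes "finite S" "S \<subseteq> F"
  shows "\<exists>\<psi>\<in>F. \<forall>M a. models M \<psi> a \<longleftrightarrow> (\<forall>\<phi>\<in>S. models M \<phi> a)"
  using assms
proof (induction S)
  case empty
  \<comment> \<open>A valid sentence holds of the empty tuple too, where \<open>models\<close>
    rejects any formula with a free variable.\<close>
  have "\<forall>M a. models M (Exists (Eq (Var 0) (Var 0))) a"
    by (simp add: models_def)
  then show ?case using F_Exists[OF F_Eq] by blast
next
  case (insert \<phi> S)
  then obtain \<psi> where "\<psi> \<in> F" "\<forall>M a. models M \<psi> a \<longleftrightarrow> (\<forall>\<phi>\<in>S. models M \<phi> a)"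
    by blast
  then show ?case
    using insert.prems by (intro bexI[of _ "And \<phi> \<psi>"]) (auto simp: models_And F_And)
qed

lemma distinct_formula:
  "\<exists>\<psi>\<in>F. \<forall>M a. length a = k \<longrightarrow> (models M \<psi> a \<longleftrightarrow> distinct a)"
proof -
  define S :: "('f, 'r) fm set"
    where "S = (\<lambda>(i, j). Neg (Eq (Var i) (Var j))) ` {(i, j) \<in> {..<k} \<times> {..<k}. i \<noteq> j}"
  have fin: "finite {(i, j) \<in> {..<k} \<times> {..<k}. i \<noteq> j}"
    by (rule finite_subset[of _ "{..<k} \<times> {..<k}"]) auto
  have "finite S" unfolding S_def using fin by (rule finite_imageI)
  moreover have "S \<subseteq> F" by (auto simp: S_def intro: F_Neg F_Eq)
  ultimately obtain \<psi> where \<psi>: "\<psi> \<in> F" "\<And>M a. models M \<psi> a \<longleftrightarrow> (\<forall>\<phi>\<in>S. models M \<phi> a)"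
    using conj_formula by metis
  have "(\<forall>\<phi>\<in>S. models M \<phi> a) \<longleftrightarrow> distinct a" if "length a = k" for M and a :: "nat list"
    using that by (auto simp: S_def models_def distinct_conv_nth)
  with \<psi> show ?thesis by blast
qed

text \<open>\<open>c\<close> lists the positions in \<open>a\<close> that the variables of
  \<open>\<phi>\<close> refer to, in any order and possibly with repetitions; substitute
  accordingly.\<close>

lemma rename_formula:
  assumes "\<phi> \<in> F" "fv \<phi> \<subseteq> {..<length c}"
  shows "\<exists>\<psi>\<in>F. \<forall>M a. set c \<subseteq> {..<length a} \<longrightarrow>
    (models M \<psi> a \<longleftrightarrow> models M \<phi> (map ((!) a) c))"
proof (intro bexI allI impI)
  show "subst (\<lambda>i. Var (c ! i)) \<phi> \<in> F" using assms(1) by (rule F_rename)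
  fix M :: "('f, 'r) lstruct" and a :: "nat list"
  assume c: "set c \<subseteq> {..<length a}"
  have "sat M (\<lambda>i. a ! (c ! i)) \<phi> = sat M ((!) (map ((!) a) c)) \<phi>"
    using assms(2) by (intro sat_cong) auto
  moreover have "c ! i < length a" if "i \<in> fv \<phi>" for i
    using that assms(2) c nth_mem by blast
  ultimately show "models M (subst (\<lambda>i. Var (c ! i)) \<phi>) a \<longleftrightarrow> models M \<phi> (map ((!) a) c)"
    using assms(2) by (auto simp: models_def fv_subst sat_subst)
qed

lemma exists_formula:
  assumes "\<phi> \<in> F" "fv \<phi> \<subseteq> {..<Suc k}"
  shows "\<exists>\<psi>\<in>F. fv \<psi> \<subseteq> {..<k} \<and>
    (\<forall>M a. length a = k \<longrightarrow> (models M \<psi> a \<longleftrightarrow> (\<exists>x. models M \<phi> (a @ [x]))))"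
proof (intro bexI conjI allI impI)
  \<comment> \<open>The entry to be quantified comes last, at position \<open>k\<close>, but
    \<open>Exists\<close> binds variable \<open>0\<close>: \<open>s\<close> sends \<open>k\<close>
    to \<open>0\<close> and raises the others.\<close>
  define s where "s i = (if i < k then Suc i else 0)" for i
  show "Exists (subst (\<lambda>i. Var (s i)) \<phi>) \<in> F"
    using assms(1) by (intro F_Exists F_rename)
  show "fv (Exists (subst (\<lambda>i. Var (s i)) \<phi>)) \<subseteq> {..<k}"
    by (auto simp: fv_subst s_def split: if_splits)
  fix M :: "('f, 'r) lstruct" and a :: "nat list"
  assume a: "length a = k"
  have "sat M (\<lambda>i. case_nat x ((!) a) (s i)) \<phi> = sat M ((!) (a @ [x])) \<phi>" for x
    using assms(2) a by (intro sat_cong) (auto simp: s_def nth_append less_Suc_eq)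
  then show "models M (Exists (subst (\<lambda>i. Var (s i)) \<phi>)) a \<longleftrightarrow> (\<exists>x. models M \<phi> (a @ [x]))"
    using assms(2) a by (auto simp: models_def fv_subst sat_subst s_def split: if_splits)
qed

lemma exists_tuple_formula:
  assumes "\<phi> \<in> F" "fv \<phi> \<subseteq> {..<k + m}"
  shows "\<exists>\<psi>\<in>F. \<forall>M a. length a = k \<longrightarrow>
    (models M \<psi> a \<longleftrightarrow> (\<exists>b. length b = m \<and> models M \<phi> (a @ b)))"
  using assms
proof (induction m arbitrary: \<phi>)
  case 0
  then show ?case by (intro bexI[of _ \<phi>]) auto
next
  case (Suc m)
  obtain \<theta> where \<theta>: "\<theta> \<in> F" "fv \<theta> \<subseteq> {..<k + m}" "\<And>M a. length a = k + m \<Longrightarrow>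
      models M \<theta> a \<longleftrightarrow> (\<exists>x. models M \<phi> (a @ [x]))"
    using exists_formula[of \<phi> "k + m"] Suc.prems by auto
  obtain \<psi> where \<psi>: "\<psi> \<in> F" "\<And>M a. length a = k \<Longrightarrow>
      models M \<psi> a \<longleftrightarrow> (\<exists>b. length b = m \<and> models M \<theta> (a @ b))"
    using Suc.IH[OF \<theta>(1,2)] by blast
  have "(\<exists>b. length b = m \<and> models M \<theta> (a @ b)) \<longleftrightarrow>
      (\<exists>b. length b = Suc m \<and> models M \<phi> (a @ b))"
    if "length a = k" for M :: "('f, 'r) lstruct" and a
  proof -
    have "(\<exists>b. length b = m \<and> models M \<theta> (a @ b)) \<longleftrightarrow>
        (\<exists>b x. length b = m \<and> models M \<phi> (a @ b @ [x]))"
      using \<theta>(3)[of "a @ b" for b] that by (metis append_assoc length_append)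
    also have "\<dots> \<longleftrightarrow> (\<exists>b. length b = Suc m \<and> models M \<phi> (a @ b))"
      unfolding length_Suc_conv_rev by blast
    finally show ?thesis .
  qed
  with \<psi> show ?case by (intro bexI[of _ \<psi>]) auto
qed

text \<open>Forth step for plain \<open>F\<close>-types: the existence of an injective extension
  satisfying \<open>\<phi>\<close> at the positions \<open>c\<close> is itself an
  \<open>F\<close>-formula about \<open>b\<close>, so it passes to \<open>a\<close>.\<close>

lemma models_extension:
  assumes "\<And>\<phi>. \<phi> \<in> F \<Longrightarrow> models N \<phi> b \<Longrightarrow> models M \<phi> a" "length a = length b"
    and "\<phi> \<in> F" "models N \<phi> (map ((!) b') c)" "set c \<subseteq> {..<length b'}"
    and "prefix b b'" "distinct b'"
  shows "\<exists>a'. prefix a a' \<and> distinct a' \<and> length a' = length b' \<and> models M \<phi> (map ((!) a') c)"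
proof -
  obtain r where b': "b' = b @ r" using assms(6) by (auto simp: prefix_def)
  define k m where "k = length b" and "m = length r"
  have "fv \<phi> \<subseteq> {..<length c}" using assms(4) by (simp add: models_def)
  then obtain \<psi> where \<psi>: "\<psi> \<in> F" "\<And>M a. set c \<subseteq> {..<length a} \<Longrightarrow>
      models M \<psi> a \<longleftrightarrow> models M \<phi> (map ((!) a) c)"
    using rename_formula[OF assms(3)] by blast
  \<comment> \<open>\<open>\<delta>\<close> keeps the extension injective, that is, a forcing
    condition.\<close>
  obtain \<delta> where \<delta>: "\<delta> \<in> F" "\<And>M a. length a = k + m \<Longrightarrow> models M \<delta> a \<longleftrightarrow> distinct a"
    using distinct_formula by blast
  have N: "models N (And \<psi> \<delta>) (b @ r)"
    using assms(4,5,7) \<psi>(2) \<delta>(2)[of "b @ r" N] by (simp add: b' models_And k_def m_def)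
  then have "fv (And \<psi> \<delta>) \<subseteq> {..<k + m}" by (simp add: models_def k_def m_def)
  then obtain \<theta> where \<theta>: "\<theta> \<in> F" "\<And>M a. length a = k \<Longrightarrow>
      models M \<theta> a \<longleftrightarrow> (\<exists>r. length r = m \<and> models M (And \<psi> \<delta>) (a @ r))"
    using exists_tuple_formula[OF F_And[OF \<psi>(1) \<delta>(1)]] by blast
  have "models N \<theta> b" using \<theta>(2) N by (auto simp: k_def m_def)
  then have "models M \<theta> a" using assms(1) \<theta>(1) by blast
  then obtain s where s: "length s = m" "models M (And \<psi> \<delta>) (a @ s)"
    using \<theta>(2) assms(2) k_def by auto
  have len: "length (a @ s) = length b'" using s(1) assms(2) by (simp add: b' m_def)
  have "models M \<phi> (map ((!) (a @ s)) c)"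
    using s(2) \<psi>(2)[of "a @ s" M] assms(5) len by (simp add: models_And)
  moreover have "distinct (a @ s)"
    using s(2) \<delta>(2)[of "a @ s" M] len by (simp add: models_And b' k_def m_def)
  ultimately show ?thesis using len by (intro exI[of _ "a @ s"]) simp
qed


section \<open>Ordinals and iterated types\<close>

lemma plus_cord_Least: "\<alpha> + \<beta> = (LEAST \<delta>. \<alpha> \<le> \<delta> \<and> (\<forall>\<gamma><\<beta>. \<alpha> + \<gamma> < \<delta>))" for \<alpha> \<beta> :: cord
  unfolding plus_cord_def by (subst cord_add.simps) (simp add: Ball_def)

text \<open>Serves to write Borel ranks between \<open>1\<close> and \<open>1 + \<beta>\<close> as
  \<open>1 + \<gamma>\<close>. For the least \<open>\<gamma>\<close> with
  \<open>\<eta> \<le> \<alpha> + \<gamma>\<close>, minimality makes \<open>\<eta>\<close> satisfy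
  the conditions whose least solution is \<open>\<alpha> + \<gamma>\<close>.\<close>

lemma less_plus_cordE:
  fixes \<eta> :: cord
  assumes "\<alpha> \<le> \<eta>" "\<eta> < \<alpha> + \<beta>"
  obtains \<gamma> where "\<gamma> < \<beta>" "\<eta> = \<alpha> + \<gamma>"
proof -
  \<comment> \<open>\<open>\<eta>\<close> lies below the least solution of the conditions defining
    \<open>\<alpha> + \<beta>\<close>.\<close>
  have "\<not> (\<alpha> \<le> \<eta> \<and> (\<forall>\<gamma><\<beta>. \<alpha> + \<gamma> < \<eta>))"
    using assms(2) not_less_Least unfolding plus_cord_Least[of \<alpha> \<beta>] by blast
  then have ex: "\<exists>\<gamma>. \<gamma> < \<beta> \<and> \<eta> \<le> \<alpha> + \<gamma>" using assms(1) not_less by blast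
  define \<gamma> where "\<gamma> = (LEAST \<gamma>. \<gamma> < \<beta> \<and> \<eta> \<le> \<alpha> + \<gamma>)"
  have \<gamma>: "\<gamma> < \<beta>" "\<eta> \<le> \<alpha> + \<gamma>"
    using LeastI_ex[OF ex] by (simp_all add: \<gamma>_def)
  have "\<alpha> + \<gamma>' < \<eta>" if "\<gamma>' < \<gamma>" for \<gamma>'
    using that not_less_Least[of \<gamma>' "\<lambda>\<gamma>. \<gamma> < \<beta> \<and> \<eta> \<le> \<alpha> + \<gamma>"] \<gamma>(1)
    unfolding \<gamma>_def[symmetric] by force
  then have "\<alpha> + \<gamma> \<le> \<eta>"
    using assms(1) by (subst plus_cord_Least) (rule Least_le, blast)
  with \<gamma> that show thesis by simp
qed

lemma zero_le_cord [simp]: "(0 :: cord) \<le> \<alpha>"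
  unfolding zero_cord_def by (rule Least_le) simp

section \<open>Back-and-forth properties of iterated types\<close>

text \<open>Equal nodes have the same members. The rank \<open>\<gamma>\<close> of the match stays
  open here; \<open>tp_rank\<close> identifies it with \<open>\<beta>\<close>.\<close>

lemma tp_eq_extension:
  assumes "tp F M \<alpha> a = tp F N \<alpha>' b" "\<beta> < \<alpha>" "prefix a a'"
  obtains \<gamma> b' where "\<gamma> < \<alpha>'" "prefix b b'" "tp F M \<beta> a' = tp F N \<gamma> b'"
proof -
  have "\<alpha> \<noteq> 0" using assms(2) by (metis leD zero_le_cord)
  then obtain A where A: "tp F M \<alpha> a = Node A"
      "rcset A = {tp F M \<beta> b | \<beta> b. \<beta> < \<alpha> \<and> prefix a b}"
    using tp_Node by blast
  have "\<alpha>' \<noteq> 0" using assms(1) A(1) by (auto simp: tp.simps[of _ _ \<alpha>'])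
  then obtain B where B: "tp F N \<alpha>' b = Node B"
      "rcset B = {tp F N \<gamma> b' | \<gamma> b'. \<gamma> < \<alpha>' \<and> prefix b b'}"
    using tp_Node by blast
  have "A = B" using A(1) B(1) assms(1) by simp
  moreover have "tp F M \<beta> a' \<in> rcset A" unfolding A(2) using assms(2,3) by blast
  ultimately have "tp F M \<beta> a' \<in> rcset B" by simp
  then show thesis unfolding B(2) using that by blast
qed

text \<open>Were one rank smaller, a type of that rank would be a member on one side, hence equal to
  a member of still smaller rank on the other, against the induction hypothesis.\<close>

lemma tp_rank: "tp F M \<alpha> a = tp F N \<beta> b \<Longrightarrow> \<alpha> = \<beta>"
proof (induction \<alpha> arbitrary: M a N \<beta> b rule: less_induct)
  case (less \<alpha>)
  show ?case
  proof (rule linorder_cases[of \<alpha> \<beta>])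
    assume "\<alpha> < \<beta>"
    then obtain \<gamma> a' where "\<gamma> < \<alpha>" "tp F N \<alpha> b = tp F M \<gamma> a'"
      using tp_eq_extension[OF less.prems[symmetric]] prefix_order.order_refl by metis
    then show ?thesis using less.IH[of \<gamma> M a' N \<alpha> b] by simp
  next
    assume "\<beta> < \<alpha>"
    then obtain \<gamma> b' where "\<gamma> < \<beta>" "tp F M \<beta> a = tp F N \<gamma> b'"
      using tp_eq_extension[OF less.prems] prefix_order.order_refl by metis
    then show ?thesis using less.IH[of \<beta> M a N \<gamma> b'] \<open>\<beta> < \<alpha>\<close> by simp
  qed simp
qed

lemma tp_zero: "tp F M 0 a = Base {\<phi> \<in> F. models M \<phi> a}"
  by (simp add: tp.simps[of _ _ 0])

text \<open>Under \<open>models\<close>, the equation of variable \<open>n\<close> with itself holds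
  exactly of tuples longer than \<open>n\<close>. At positive rank, \<open>tp F N 0 b\<close> is
  also the type of some extension of \<open>a\<close>, which reduces the claim to rank
  \<open>0\<close>.\<close>

lemma tp_length_le:
  assumes "tp F M \<alpha> a = tp F N \<alpha> b"
  shows "length a \<le> length b"
proof -
  have zero: "length a \<le> length b" if eq: "tp F M 0 a = tp F N 0 b"
    for a b and M N :: "('f, 'r) lstruct"
  proof (rule ccontr)
    assume "\<not> ?thesis"
    then have "models M (Eq (Var (length b)) (Var (length b))) a" by (simp add: models_def)
    moreover have "\<not> models N (Eq (Var (length b)) (Var (length b))) b" by (simp add: models_def)
    ultimately show False using eq F_Eq by (auto simp: tp_zero)
  qed
  show ?thesis
  proof (cases "\<alpha> = 0")
    case True
    then show ?thesis using zero assms by simp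
  next
    case False
    then have "0 < \<alpha>" using zero_le_cord[of \<alpha>] by (simp add: order_less_le)
    then obtain \<gamma> a' where "prefix a a'" "tp F N 0 b = tp F M \<gamma> a'"
      using tp_eq_extension[OF assms[symmetric]] prefix_order.order_refl by metis
    then have "length a \<le> length a'" "tp F M 0 a' = tp F N 0 b"
      using tp_rank by (auto dest: prefix_length_le) metis
    then show ?thesis using zero by fastforce
  qed
qed

lemma tp_length: "tp F M \<alpha> a = tp F N \<alpha> b \<Longrightarrow> length a = length b"
  using tp_length_le[of M \<alpha> a N b] tp_length_le[of N \<alpha> b M a] by simp

text \<open>Some extension of \<open>b\<close> matches \<open>a\<close> at rank
  \<open>\<beta>\<close>; equal types have equal lengths, so that extension is \<open>b\<close>
  itself.\<close>

lemma tp_mono: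
  assumes "tp F M \<alpha> a = tp F N \<alpha> b" "\<beta> \<le> \<alpha>"
  shows "tp F M \<beta> a = tp F N \<beta> b"
proof (cases "\<beta> = \<alpha>")
  case False
  then have "\<beta> < \<alpha>" using assms(2) by simp
  then obtain \<gamma> b' where b': "prefix b b'" "tp F M \<beta> a = tp F N \<gamma> b'"
    using tp_eq_extension[OF assms(1)] prefix_order.order_refl by metis
  then have eq: "tp F M \<beta> a = tp F N \<beta> b'" using tp_rank by metis
  have "length b' = length b" using tp_length[OF eq] tp_length[OF assms(1)] by simp
  then have "b' = b" using b'(1) by (auto simp: prefix_def)
  with eq show ?thesis by simp
qed (use assms in simp)

lemma tp_models:
  assumes "tp F M \<alpha> a = tp F N \<alpha> b" "\<phi> \<in> F"
  shows "models M \<phi> a \<longleftrightarrow> models N \<phi> b"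
  using tp_mono[OF assms(1), of 0] assms(2) by (auto simp: tp_zero)

lemma tp_distinct:
  assumes "tp F M \<alpha> a = tp F N \<alpha> b"
  shows "distinct a \<longleftrightarrow> distinct b"
  using distinct_formula[of "length a"] tp_models[OF assms] tp_length[OF assms] by metis

text \<open>Forth step at positive rank, with the extension again a forcing condition.\<close>

lemma tp_eq_distinct_extension:
  assumes "tp F M \<alpha> a = tp F N \<alpha> b" "\<gamma> < \<alpha>" "prefix a a'" "distinct a'"
  obtains b' where "prefix b b'" "distinct b'" "tp F M \<gamma> a' = tp F N \<gamma> b'"
proof -
  obtain \<gamma>' b' where b': "prefix b b'" "tp F M \<gamma> a' = tp F N \<gamma>' b'"
    using tp_eq_extension[OF assms(1-3)] by blast
  then have "tp F M \<gamma> a' = tp F N \<gamma> b'" using tp_rank by metis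
  with b'(1) show thesis using that tp_distinct assms(4) by metis
qed

lemma tp_isomorphism:
  assumes "bij h"
    and "\<And>f xs. f \<in> funs L \<Longrightarrow> length xs = farity L f \<Longrightarrow> h (fint M f xs) = fint N f (map h xs)"
    and "\<And>R xs. R \<in> rels L \<Longrightarrow> length xs = rarity L R \<Longrightarrow> rint M R xs = rint N R (map h xs)"
  shows "tp F M \<alpha> a = tp F N \<alpha> (map h a)"
proof (induction \<alpha> arbitrary: a rule: less_induct)
  case (less \<alpha>)
  have "models M \<phi> a = models N \<phi> (map h a)" if "\<phi> \<in> F" for \<phi> a
    by (rule models_isomorphism[OF assms F_formula[OF that]])
  then have zero: "{\<phi> \<in> F. models M \<phi> a} = {\<phi> \<in> F. models N \<phi> (map h a)}" by blast
  have "{tp F M \<beta> b | b. prefix a b} = {tp F N \<beta> b | b. prefix (map h a) b}" if "\<beta> < \<alpha>" for \<beta>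
  proof (intro equalityI subsetI)
    fix t assume "t \<in> {tp F M \<beta> b | b. prefix a b}"
    then show "t \<in> {tp F N \<beta> b | b. prefix (map h a) b}"
      using less.IH[OF that] map_mono_prefix by blast
  next
    fix t assume "t \<in> {tp F N \<beta> b | b. prefix (map h a) b}"
    then obtain b where b: "t = tp F N \<beta> b" "prefix (map h a) b" by blast
    have "map h (map (inv h) b) = b" "map (inv h) (map h a) = a"
      using assms(1) by (simp_all add: comp_def bij_is_surj surj_f_inv_f bij_is_inj)
    then have "t = tp F M \<beta> (map (inv h) b)" "prefix a (map (inv h) b)"
      using b less.IH[OF that] map_mono_prefix[OF b(2), of "inv h"] by metis+
    then show "t \<in> {tp F M \<beta> b | b. prefix a b}" by blast
  qed
  then have "(\<Union>\<beta>\<in>{..<\<alpha>}. {tp F M \<beta> b | b. prefix a b}) =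
      (\<Union>\<beta>\<in>{..<\<alpha>}. {tp F N \<beta> b | b. prefix (map h a) b})"
    by (intro SUP_cong) auto
  then show ?case
    using zero by (subst (1 2) tp.simps) simp
qed

lemma Th_isomorphic:
  assumes "isomorphic L M N"
  shows "Th F \<alpha> M = Th F \<alpha> N"
proof -
  obtain h where "bij h"
    "\<And>f xs. f \<in> funs L \<Longrightarrow> length xs = farity L f \<Longrightarrow> h (fint M f xs) = fint N f (map h xs)"
    "\<And>R xs. R \<in> rels L \<Longrightarrow> length xs = rarity L R \<Longrightarrow> rint M R xs = rint N R (map h xs)"
    using assms unfolding isomorphic_def by blast
  then show ?thesis using tp_isomorphism[of h M N \<alpha> "[]"] by (simp add: Th_def)
qed


section \<open>Forcing membership in Borel sets of structures\<close>

lemma topspace_t_top: "topspace (t_top L F) = Mod L"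
proof
  show "topspace (t_top L F) \<subseteq> Mod L"
    unfolding t_top_def topology_generated_by_topspace by auto
  have "M \<in> {M \<in> Mod L. models M (Eq (Var 0) (Var 0)) [0]}" if "M \<in> Mod L" for M
    using that by (simp add: models_def)
  then show "Mod L \<subseteq> topspace (t_top L F)"
    unfolding t_top_def topology_generated_by_topspace using F_Eq by blast
qed

definition ensures :: "('f, 'r) lstruct set \<Rightarrow> ('f, 'r) fm \<Rightarrow> nat list \<Rightarrow> bool" where
  "ensures U \<phi> a \<longleftrightarrow> \<phi> \<in> F \<and> (\<forall>N\<in>Mod L. models N \<phi> a \<longrightarrow> N \<in> U)"

text \<open>The generating sets form a base: two of them intersect in another, given by the
  concatenated tuple and the conjunction of the renamed formulas.\<close>

lemma openin_t_top_base:
  assumes "openin (t_top L F) U" "M \<in> U"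
  shows "\<exists>\<phi> a. ensures U \<phi> a \<and> models M \<phi> a"
proof -
  have "generate_topology_on {{M \<in> Mod L. models M \<phi> a} | \<phi> a. \<phi> \<in> F} U"
    using assms(1) by (simp add: t_top_def openin_topology_generated_by_iff)
  then show ?thesis using assms(2)
  proof (induction arbitrary: M)
    case (Int U V)
    then obtain \<phi> a \<psi> b where *: "ensures U \<phi> a" "models M \<phi> a" "ensures V \<psi> b" "models M \<psi> b"
      by (metis IntE)
    \<comment> \<open>The positions of \<open>a\<close> and of \<open>b\<close> within
      \<open>a @ b\<close>.\<close>
    define c d where "c = [0..<length a]" and "d = [length a..<length a + length b]"
    have c: "set c \<subseteq> {..<length (a @ b)}" "map ((!) (a @ b)) c = a"
      and d: "set d \<subseteq> {..<length (a @ b)}" "map ((!) (a @ b)) d = b"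
      by (auto simp: c_def d_def nth_append intro: nth_equalityI)
    have "fv \<phi> \<subseteq> {..<length c}" "fv \<psi> \<subseteq> {..<length d}"
      using * by (simp_all add: models_def c_def d_def)
    then obtain \<phi>' \<psi>' where r: "\<phi>' \<in> F" "\<psi>' \<in> F"
      "\<And>N. models N \<phi>' (a @ b) = models N \<phi> a" "\<And>N. models N \<psi>' (a @ b) = models N \<psi> b"
      using rename_formula[of \<phi> c] rename_formula[of \<psi> d] * c d unfolding ensures_def by metis
    then have "ensures (U \<inter> V) (And \<phi>' \<psi>') (a @ b)" "models M (And \<phi>' \<psi>') (a @ b)"
      using * by (auto simp: ensures_def models_And F_And)
    then show ?case by blast
  next
    case (UN K)
    then obtain U where "U \<in> K" "M \<in> U" by blast
    with UN.IH obtain \<phi> a where "ensures U \<phi> a" "models M \<phi> a" by blast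
    then show ?case using \<open>U \<in> K\<close> unfolding ensures_def by blast
  next
    case (Basis U)
    then show ?case unfolding ensures_def by blast
  qed simp
qed

text \<open>Up to inverting \<open>g\<close>, \<open>forces p (copies_in M A)\<close> puts
  \<open>M\<close> into the Vaught transform of \<open>A\<close> at the basic open set of
  \<open>p\<close>.\<close>

definition copies_in :: "('f, 'r) lstruct \<Rightarrow> ('f, 'r) lstruct set \<Rightarrow> (nat \<Rightarrow> nat) set" where
  "copies_in M A = {g. pullback L g M \<in> A}"

lemma copies_in_UN: "copies_in M (\<Union>n. A n) = (\<Union>n. copies_in M (A n))"
  by (auto simp: copies_in_def)

lemma copies_in_Compl: "M \<in> Mod L \<Longrightarrow> copies_in M (topspace (t_top L F) - A) = - copies_in M A"
  by (auto simp: copies_in_def topspace_t_top pullback_Mod)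

text \<open>In the copy along \<open>g\<close>, the number \<open>i\<close> stands for
  \<open>g i\<close>, which is \<open>p ! i\<close> for \<open>i < length p\<close>; so
  \<open>p\<close> alone settles \<open>\<phi>\<close> at \<open>a\<close>.\<close>

lemma forces_ensures:
  assumes "M \<in> Mod L" "ensures U \<phi> a" "set a \<subseteq> {..<length p}" "models M \<phi> (map ((!) p) a)"
  shows "forces p (copies_in M U)"
proof (rule forces_all)
  fix g assume g: "bij g" "initial_segment p g"
  have "map ((!) p) a = map g a"
    using assms(3) initial_segment_nth[OF g(2)] by auto
  then have "models M \<phi> (map g a)" using assms(4) by metis
  then have "models (pullback L g M) \<phi> a"
    using assms(2) g(1) by (simp add: ensures_def F_formula models_pullback)
  then show "g \<in> copies_in M U"
    using assms(1,2) by (simp add: ensures_def copies_in_def pullback_Mod)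
qed

lemma copy_in_open:
  assumes "openin (t_top L F) U" "bij g" "initial_segment p g" "g \<in> copies_in M U"
  obtains q \<phi> a where "distinct q" "prefix p q" "ensures U \<phi> a" "set a \<subseteq> {..<length q}"
    "models M \<phi> (map ((!) q) a)"
proof -
  obtain \<phi> a where \<phi>: "ensures U \<phi> a" "models (pullback L g M) \<phi> a"
    using openin_t_top_base[OF assms(1), of "pullback L g M"] assms(4)
    by (auto simp: copies_in_def)
  obtain k where k: "set a \<subseteq> {..<k}" using finite_nat_iff_bounded by auto
  \<comment> \<open>\<open>q\<close> is long enough to fix \<open>g\<close> on all entries of
    \<open>a\<close> and to extend \<open>p\<close>.\<close>
  define q where "q = map g [0..<max k (length p)]"
  have "map ((!) q) a = map g a" using k by (auto simp: q_def)
  moreover have "models M \<phi> (map g a)"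
    using \<phi> assms(2) by (simp add: ensures_def F_formula models_pullback)
  ultimately have "models M \<phi> (map ((!) q) a)" by metis
  moreover have "distinct q"
    using assms(2) by (auto simp: q_def distinct_map bij_def intro: inj_on_subset)
  moreover have "prefix p q"
    unfolding q_def by (rule initial_segment_prefix_upt[OF assms(3)]) simp
  moreover have "set a \<subseteq> {..<length q}" using k by (auto simp: q_def)
  ultimately show thesis using that \<phi>(1) by blast
qed

text \<open>If some \<open>g\<close> through \<open>p\<close> copies \<open>M\<close> into
  \<open>U\<close>, a finite piece of \<open>g\<close> forces this; otherwise \<open>p\<close>
  forces the complement.\<close>

lemma decided_open:
  assumes "M \<in> Mod L" "openin (t_top L F) U"
  shows "decided (copies_in M U)"
  unfolding decided_def dense_tuples_def
proof (intro allI impI)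
  fix p :: "nat list" assume p: "distinct p"
  show "\<exists>q\<in>{q. forces q (copies_in M U) \<or> forces q (- copies_in M U)}. distinct q \<and> prefix p q"
  proof (cases "\<exists>g. bij g \<and> initial_segment p g \<and> g \<in> copies_in M U")
    case True
    then show ?thesis
      using copy_in_open[OF assms(2)] forces_ensures[OF assms(1)] by (metis (lifting) mem_Collect_eq)
  next
    case False
    then have "forces p (- copies_in M U)" by (intro forces_all) blast
    then show ?thesis using p by blast
  qed
qed

text \<open>The Baire property of Borel sets, by induction on their construction.\<close>

lemma decided_Borel:
  assumes "M \<in> Mod L"
  shows "Sigma0 (t_top L F) \<xi> A \<Longrightarrow> decided (copies_in M A)"
    and "Pi0 (t_top L F) \<xi> A \<Longrightarrow> decided (copies_in M A)"
proof (induction rule: Sigma0_Pi0.inducts)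
  case (Sigma0_open U)
  then show ?case using assms by (rule decided_open[rotated])
next
  case (Sigma0_Union \<xi> \<eta> A)
  then show ?case by (simp add: copies_in_UN decided_UN)
next
  case (Pi0_compl \<xi> U)
  then show ?case using assms by (simp add: copies_in_Compl decided_Compl)
qed

text \<open>The induction ranges over all pairs of structures: under a complement \<open>M\<close>
  and \<open>N\<close> change sides, so the induction hypothesis is applied from \<open>N\<close> to
  \<open>M\<close>.\<close>

lemma forces_Pi0_transfer:
  assumes "M \<in> Mod L" "N \<in> Mod L" "distinct p" "distinct p'"
    and "tp F M \<beta> p = tp F N \<beta> p'" "Pi0 (t_top L F) (1 + \<beta>) A"
    and "forces p (copies_in M A)"
  shows "forces p' (copies_in N A)"
  using assms
proof (induction \<beta> arbitrary: M N p p' A rule: less_induct)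
  case (less \<beta>)
  obtain U where A: "A = topspace (t_top L F) - U" and U: "Sigma0 (t_top L F) (1 + \<beta>) U"
    using less.prems(6) by (auto elim: Pi0.cases)
  have M: "\<not> (\<exists>q. distinct q \<and> prefix p q \<and> forces q (copies_in M U))"
    using less.prems(1,3,7) forces_Compl_iff[OF decided_Borel(1)[OF less.prems(1) U]]
    by (simp add: A copies_in_Compl)
  have "\<not> (\<exists>q. distinct q \<and> prefix p' q \<and> forces q (copies_in N U))"
  proof
    assume "\<exists>q. distinct q \<and> prefix p' q \<and> forces q (copies_in N U)"
    then obtain q where q: "distinct q" "prefix p' q" "forces q (copies_in N U)" by blast
    from U show False
    proof (cases rule: Sigma0.cases)
      \<comment> \<open>Here only the \<open>F\<close>-formulas true of \<open>p\<close> and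
        \<open>p'\<close> matter; \<open>models_extension\<close> carries the witness from
        \<open>N\<close> to \<open>M\<close>.\<close>
      case Sigma0_open
      obtain g where "bij g" "initial_segment q g" "g \<in> copies_in N U"
        using forces_generic[OF q(3,1)] by blast
      then obtain r \<phi> a where r: "distinct r" "prefix q r" "ensures U \<phi> a"
          "set a \<subseteq> {..<length r}" "models N \<phi> (map ((!) r) a)"
        using copy_in_open[OF Sigma0_open(2)] by metis
      have "\<exists>s. prefix p s \<and> distinct s \<and> length s = length r \<and> models M \<phi> (map ((!) s) a)"
      proof (rule models_extension[OF _ _ _ r(5,4) _ r(1)])
        show "prefix p' r" using q(2) r(2) by (rule prefix_order.order_trans)
        show "length p = length p'" using less.prems(5) by (rule tp_length)
        show "\<phi> \<in> F" using r(3) by (simp add: ensures_def)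
      qed (use tp_models[OF less.prems(5)] in blast)
      then show False using M forces_ensures[OF less.prems(1) r(3)] r(4) by metis
    next
      case (Sigma0_Union \<eta> B)
      have dec: "decided (copies_in N (B n))" for n
        using Sigma0_Union(3) decided_Borel(2)[OF less.prems(2)] by blast
      have "forces q (\<Union>n. copies_in N (B n))"
        using q(3) by (simp add: Sigma0_Union(1) copies_in_UN)
      then obtain n r where r: "distinct r" "prefix q r" "forces r (copies_in N (B n))"
        using forces_UN[of "\<lambda>n. copies_in N (B n)", OF dec q(1)] by blast
      \<comment> \<open>The rank of \<open>B n\<close> again has the form
        \<open>1 + \<gamma>\<close>, so the types of rank \<open>\<gamma>\<close>, members of those
        of rank \<open>\<beta>\<close>, are the ones to compare.\<close>
      obtain \<gamma> where \<gamma>: "\<gamma> < \<beta>" "\<eta> n = 1 + \<gamma>"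
        using Sigma0_Union(3)[of n] less_plus_cordE by metis
      obtain s where s: "prefix p s" "distinct s" "tp F N \<gamma> r = tp F M \<gamma> s"
        using tp_eq_distinct_extension[OF less.prems(5)[symmetric] \<gamma>(1) _ r(1)]
          prefix_order.order_trans[OF q(2) r(2)] by blast
      have "Pi0 (t_top L F) (1 + \<gamma>) (B n)" using Sigma0_Union(3)[of n] \<gamma>(2) by simp
      then have "forces s (copies_in M (B n))"
        using less.IH[OF \<gamma>(1) less.prems(2,1) r(1) s(2,3)] r(3) by blast
      then have "forces s (copies_in M U)"
        by (rule forces_mono) (auto simp: Sigma0_Union(1) copies_in_def)
      then show False using M s by blast
    qed
  qed
  then show ?case
    using less.prems(2,4) forces_Compl_iff[OF decided_Borel(1)[OF less.prems(2) U]]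
    by (simp add: A copies_in_Compl)
qed

end

theorem theorem5p1:
  fixes L :: "('f, 'r) signature" and F :: "('f, 'r) fm set"
    and M :: "('f, 'r) lstruct" and \<alpha> :: cord
  assumes "countable_signature L"
    and "fragment L F"
    and "M \<in> Mod L"
    and "1 \<le> \<alpha>"
    and "Pi0 (t_top L F) (1 + \<alpha>) (iso_class L M)"
  shows "iso_class L M = {N \<in> Mod L. Th F \<alpha> N = Th F \<alpha> M}"
proof (intro equalityI subsetI)
  fix N assume "N \<in> iso_class L M"
  then show "N \<in> {N \<in> Mod L. Th F \<alpha> N = Th F \<alpha> M}"
    using Th_isomorphic[OF assms(2), of M N \<alpha>] by (simp add: iso_class_def)
next
  fix N assume "N \<in> {N \<in> Mod L. Th F \<alpha> N = Th F \<alpha> M}"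
  then have N: "N \<in> Mod L" "tp F M \<alpha> [] = tp F N \<alpha> []" by (simp_all add: Th_def)
  have "forces [] (copies_in L M (iso_class L M))"
    using assms(3) by (intro forces_all)
      (simp add: copies_in_def[OF assms(2)] iso_class_def pullback_Mod isomorphic_pullback isomorphic_sym)
  \<comment> \<open>\<open>N(2)\<close> equates the types of the empty tuple, the condition that
    every permutation extends.\<close>
  then have "forces [] (copies_in L N (iso_class L M))"
    using forces_Pi0_transfer[OF assms(2,3) N(1) _ _ N(2) assms(5)] by simp
  then obtain g where g: "bij g" "g \<in> copies_in L N (iso_class L M)"
    by (rule forces_generic) simp_all
  then have "isomorphic L M (pullback L g N)"
    by (simp add: copies_in_def[OF assms(2)] iso_class_def)
  then show "N \<in> iso_class L M"
    using N(1) isomorphic_trans[OF _ isomorphic_pullback[OF g(1)]] by (simp add: iso_class_def)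
qed

end
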